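(* Let $E$ be a symmetric space on $I$. If $x\in E$ is a point of $K$-order continuity and an LKM point of $E$, and $x^*(\infty)=0$, then $x$ is an LLUKM point of $E$.
   Context: Let $I=[0,\alpha)$ with $\alpha=1$ or $\alpha=\infty$, with Lebesgue measure $\mu$, and let $L^0$ be the set of (equivalence classes of) extended real valued measurable functions on $I$. A Banach function space $(E,\|\cdot\|_E)$ is a Banach lattice that is a sublattice of $L^0$ such that (1) $x\in L^0$, $y\in E$, $|x|\le|y|$ a.e. imply $x\in E$ and $\|x\|_E\le\|y\|_E$; (2) $E$ contains a strictly positive function. $E^+=\{x\in E:x\ge0\}$. For $x\in L^0$: $d_x(\lambda)=\mu\{s\in I:|x(s)|>\lambda\}$, $x^*(t)=\inf\{\lambda>0:d_x(\lambda)\le t\}$, $x^{**}(t)=\frac1t\int_0^t x^*(s)\,ds$; $x^*(\infty)=\lim_{t\to\infty}x^*(t)$ if $\alpha=\infty$ and $x^*(\infty)=0$ if $\alpha=1$. $E$ is symmetric if $x\in L^0$, $y\in E$, $d_x=d_y$ imply $x\in E$ and $\|x\|_E=\|y\|_E$. Standing assumption: $E$ has the Fatou property, i.e. if $(x_n)\subset E^+$, $\sup_n\|x_n\|_E<\infty$ and $x_n\uparrow x\in L^0$, then $x\in E$ and $\|x_n\|_E\uparrow\|x\|_E$. For $x,y\in L^1+L^\infty$, $x\prec y$ means $x^{**}(t)\le y^{**}(t)$ for all $t>0$. $x\in E$ is a point of $K$-order continuity if for every $(x_n)\subset E$ with $x_n\prec x$ for all $n$ and $x_n^*\to0$ a.e.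 we have $\|x_n\|_E\to0$. $x\in E$ is an LKM point (point of lower $K$-monotonicity) if for every $y\in E$ with $x^*\ne y^*$ and $y\prec x$ we have $\|y\|_E<\|x\|_E$. $x\in E$ is an LLUKM point (point of lower local uniform $K$-monotonicity) if for every $(x_n)\subset E$ with $x_n\prec x$ for all $n$ and $\|x_n\|_E\to\|x\|_E$ we have $\|x^*-x_n^*\|_E\to0$. *)

theory Defs
  imports "HOL-Analysis.Analysis"
begin

text \<open>
  The interval \<open>I = [0, \<alpha>)\<close> is given by its right end point \<open>\<alpha> :: ereal\<close> (which is \<open>1\<close> or \<open>\<infinity>\<close>).
  Elements of \<open>L\<^sup>0\<close> are represented by functions \<open>real \<Rightarrow> ereal\<close>. Only their values on \<open>I\<close>, and
  these only up to a.e. equality, matter: relations between elements of \<open>L\<^sup>0\<close> are a.e. relations.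
\<close>

definition I_meas :: "ereal \<Rightarrow> real measure" where
  "I_meas \<alpha> = lebesgue_on {s. 0 \<le> s \<and> ereal s < \<alpha>}"

definition L0 :: "ereal \<Rightarrow> (real \<Rightarrow> ereal) set" where
  "L0 \<alpha> = borel_measurable (I_meas \<alpha>)"

text \<open>
  The function space consists of a set \<open>E\<close> of functions and a norm \<open>N\<close>, which is meaningful on
  \<open>E\<close> only. Pointwise addition is an operation on equivalence classes only for functions that
  are finite a.e., so \<open>finite_AE\<close> is part of \<open>E\<close> being a vector space. By \<open>ideal\<close>, both \<open>E\<close> and
  \<open>N\<close> are invariant under a.e. equality, and \<open>N\<close> is a lattice norm.
\<close>

locale banach_function_space =
  fixes \<alpha> :: ereal
    and E :: "(real \<Rightarrow> ereal) set"
    and N :: "(real \<Rightarrow> ereal) \<Rightarrow> real"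
  assumes subset_L0: "E \<subseteq> L0 \<alpha>"
    and finite_AE: "x \<in> E \<Longrightarrow> AE s in I_meas \<alpha>. \<bar>x s\<bar> < \<infinity>"
    and zero_mem: "(\<lambda>s. 0) \<in> E"
    and add_mem: "x \<in> E \<Longrightarrow> y \<in> E \<Longrightarrow> (\<lambda>s. x s + y s) \<in> E"
    and scale_mem: "x \<in> E \<Longrightarrow> (\<lambda>s. ereal c * x s) \<in> E"
    and sup_mem: "x \<in> E \<Longrightarrow> y \<in> E \<Longrightarrow> (\<lambda>s. max (x s) (y s)) \<in> E"
    and inf_mem: "x \<in> E \<Longrightarrow> y \<in> E \<Longrightarrow> (\<lambda>s. min (x s) (y s)) \<in> E"
    and norm_nonneg: "x \<in> E \<Longrightarrow> 0 \<le> N x"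
    and norm_eq_0_iff: "x \<in> E \<Longrightarrow> N x = 0 \<longleftrightarrow> (AE s in I_meas \<alpha>. x s = 0)"
    and norm_scale: "x \<in> E \<Longrightarrow> N (\<lambda>s. ereal c * x s) = \<bar>c\<bar> * N x"
    and norm_triangle: "x \<in> E \<Longrightarrow> y \<in> E \<Longrightarrow> N (\<lambda>s. x s + y s) \<le> N x + N y"
    and norm_complete: "\<lbrakk>\<And>n::nat. X n \<in> E;
          \<And>e. e > 0 \<Longrightarrow> \<exists>M. \<forall>m\<ge>M. \<forall>n\<ge>M. N (\<lambda>s. X m s - X n s) < e\<rbrakk>
        \<Longrightarrow> \<exists>x\<in>E. (\<lambda>n. N (\<lambda>s. X n s - x s)) \<longlonglongrightarrow> 0"
    and ideal: "\<lbrakk>x \<in> L0 \<alpha>; y \<in> E; AE s in I_meas \<alpha>. \<bar>x s\<bar> \<le> \<bar>y s\<bar>\<rbrakk> \<Longrightarrow> x \<in> E \<and> N x \<le> N y"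
    and strictly_positive_mem: "\<exists>w\<in>E. AE s in I_meas \<alpha>. 0 < w s"

definition distr_fun :: "ereal \<Rightarrow> (real \<Rightarrow> ereal) \<Rightarrow> real \<Rightarrow> ennreal" where
  "distr_fun \<alpha> x l = emeasure (I_meas \<alpha>) {s \<in> space (I_meas \<alpha>). ereal l < \<bar>x s\<bar>}"

text \<open>
  For \<open>t < 0\<close> the value of the rearrangement is the one at \<open>t = 0\<close>, because \<open>ennreal t = 0\<close>. Since
  \<open>x\<^sup>*\<close> is right-continuous, equality of \<open>decr_rearr \<alpha> x\<close> and \<open>decr_rearr \<alpha> y\<close> as functions is the
  same as a.e. equality on \<open>I\<close>.
\<close>

definition decr_rearr :: "ereal \<Rightarrow> (real \<Rightarrow> ereal) \<Rightarrow> real \<Rightarrow> ereal" where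
  "decr_rearr \<alpha> x t = Inf {ereal l |l. 0 < l \<and> distr_fun \<alpha> x l \<le> ennreal t}"

definition decr_rearr_infty :: "ereal \<Rightarrow> (real \<Rightarrow> ereal) \<Rightarrow> ereal" where
  "decr_rearr_infty \<alpha> x = (if \<alpha> = \<infinity> then Lim at_top (decr_rearr \<alpha> x) else 0)"

definition maximal_fun :: "ereal \<Rightarrow> (real \<Rightarrow> ereal) \<Rightarrow> real \<Rightarrow> ennreal" where
  "maximal_fun \<alpha> x t = (\<integral>\<^sup>+ s\<in>{0..t}. e2ennreal (decr_rearr \<alpha> x s) \<partial>lebesgue) / ennreal t"

text \<open>
  The relation \<open>x \<prec> y\<close> is meant for \<open>x, y \<in> L\<^sup>1 + L\<^sup>\<infinity>\<close>, which contains every symmetric space;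
  there the maximal functions are finite.
\<close>

definition hlp_le :: "ereal \<Rightarrow> (real \<Rightarrow> ereal) \<Rightarrow> (real \<Rightarrow> ereal) \<Rightarrow> bool" where
  "hlp_le \<alpha> x y \<longleftrightarrow> (\<forall>t>0. maximal_fun \<alpha> x t \<le> maximal_fun \<alpha> y t)"

locale symmetric_space = banach_function_space +
  assumes symmetric:
    "\<lbrakk>x \<in> L0 \<alpha>; y \<in> E; distr_fun \<alpha> x = distr_fun \<alpha> y\<rbrakk> \<Longrightarrow> x \<in> E \<and> N x = N y"

definition fatou_property ::
    "ereal \<Rightarrow> (real \<Rightarrow> ereal) set \<Rightarrow> ((real \<Rightarrow> ereal) \<Rightarrow> real) \<Rightarrow> bool" where
  "fatou_property \<alpha> E N \<longleftrightarrow>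
     (\<forall>X x. (\<forall>n::nat. X n \<in> E \<and> (AE s in I_meas \<alpha>. 0 \<le> X n s))
        \<and> bdd_above (range (\<lambda>n. N (X n)))
        \<and> x \<in> L0 \<alpha>
        \<and> (AE s in I_meas \<alpha>. incseq (\<lambda>n. X n s) \<and> (\<lambda>n. X n s) \<longlonglongrightarrow> x s)
        \<longrightarrow> x \<in> E \<and> incseq (\<lambda>n. N (X n)) \<and> (\<lambda>n. N (X n)) \<longlonglongrightarrow> N x)"

definition K_order_continuity_point ::
    "ereal \<Rightarrow> (real \<Rightarrow> ereal) set \<Rightarrow> ((real \<Rightarrow> ereal) \<Rightarrow> real) \<Rightarrow> (real \<Rightarrow> ereal) \<Rightarrow> bool" where
  "K_order_continuity_point \<alpha> E N x \<longleftrightarrow> x \<in> E \<and>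
     (\<forall>X. (\<forall>n::nat. X n \<in> E \<and> hlp_le \<alpha> (X n) x)
        \<and> (AE t in I_meas \<alpha>. (\<lambda>n. decr_rearr \<alpha> (X n) t) \<longlonglongrightarrow> 0)
        \<longrightarrow> (\<lambda>n. N (X n)) \<longlonglongrightarrow> 0)"

definition LKM_point ::
    "ereal \<Rightarrow> (real \<Rightarrow> ereal) set \<Rightarrow> ((real \<Rightarrow> ereal) \<Rightarrow> real) \<Rightarrow> (real \<Rightarrow> ereal) \<Rightarrow> bool" where
  "LKM_point \<alpha> E N x \<longleftrightarrow> x \<in> E \<and>
     (\<forall>y\<in>E. decr_rearr \<alpha> x \<noteq> decr_rearr \<alpha> y \<and> hlp_le \<alpha> y x \<longrightarrow> N y < N x)"

definition LLUKM_point ::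
    "ereal \<Rightarrow> (real \<Rightarrow> ereal) set \<Rightarrow> ((real \<Rightarrow> ereal) \<Rightarrow> real) \<Rightarrow> (real \<Rightarrow> ereal) \<Rightarrow> bool" where
  "LLUKM_point \<alpha> E N x \<longleftrightarrow> x \<in> E \<and>
     (\<forall>X. (\<forall>n::nat. X n \<in> E \<and> hlp_le \<alpha> (X n) x) \<and> (\<lambda>n. N (X n)) \<longlonglongrightarrow> N x
        \<longrightarrow> (\<lambda>n. N (\<lambda>t. decr_rearr \<alpha> x t - decr_rearr \<alpha> (X n) t)) \<longlonglongrightarrow> 0)"

end

theory Submission
  imports Defs "HOL-Library.Diagonal_Subsequence"
begin

text \<open>
  Let \<open>x\<^sub>n \<prec> x\<close> with \<open>\<parallel>x\<^sub>n\<parallel> \<rightarrow> \<parallel>x\<parallel>\<close>. By Helly selection a subsequence of \<open>x\<^sub>n\<^sup>*\<close>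
  converges a.e. to a decreasing \<open>y\<close>; the Fatou property gives \<open>y \<in> E\<close> and Fatou's lemma
  gives \<open>y \<prec> x\<close>. Since \<open>x\<^sup>*(\<infinity>) = 0\<close>, the functions
  majorized by \<open>x\<close> have uniformly small tails, so that an a.e. null sequence dominated by
  rearrangements of such functions has rearrangements tending to \<open>0\<close>. Applied to \<open>(x\<^sub>n\<^sup>* - y)\<^sup>+\<close>,
  \<open>K\<close>-order continuity yields \<open>\<parallel>x\<parallel> \<le> \<parallel>y\<parallel>\<close>, whence \<open>y = x\<^sup>*\<close> because \<open>x\<close> is an LKM point. Then the
  negative part \<open>(x\<^sup>* - x\<^sub>n\<^sup>*)\<^sup>+\<close> is dominated by \<open>x\<^sup>*\<close> and tends to \<open>0\<close> in norm for the same reason.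
\<close>

section \<open>Initial segments and Lebesgue measure on the domain\<close>

definition init_seg :: "ennreal \<Rightarrow> real set" where
  "init_seg c = {s. 0 \<le> s \<and> ennreal s < c}"

lemma init_seg_ennreal: "0 \<le> r \<Longrightarrow> init_seg (ennreal r) = {0..<r}"
  by (auto simp: init_seg_def ennreal_less_iff)

lemma init_seg_top: "init_seg top = {0..}"
  by (auto simp: init_seg_def)

lemma init_seg_sets [measurable]: "init_seg c \<in> sets borel"
  by (cases c) (auto simp: init_seg_ennreal init_seg_top)

lemma emeasure_init_seg: "emeasure lebesgue (init_seg c) = c"
proof (cases c)
  case (real r)
  then show ?thesis
    by (simp add: init_seg_ennreal emeasure_completion)
next
  case top
  have "of_nat n \<le> emeasure lebesgue {0::real..}" for n
  proof -
    have "of_nat n = emeasure lebesgue {0..<real n}"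
      by (simp add: ennreal_of_nat_eq_real_of_nat)
    also have "\<dots> \<le> emeasure lebesgue {0::real..}"
      by (rule emeasure_mono) auto
    finally show ?thesis .
  qed
  then have "emeasure lebesgue {0::real..} = top"
    by (metis ennreal_Ex_less_of_nat leD top.not_eq_extremum)
  with top show ?thesis
    by (simp add: init_seg_top)
qed

lemma init_seg_Int: "init_seg a \<inter> init_seg b = init_seg (min a b)"
  by (auto simp: init_seg_def)

text \<open>Superlevel sets of rearrangements are initial segments as well, so a length in
  \<open>ennreal\<close> lets one formula treat bounded and unbounded domains and these level sets
  alike.\<close>

lemma domain_eq_init_seg: "{s. 0 \<le> s \<and> ereal s < \<alpha>} = init_seg (e2ennreal \<alpha>)"
proof (cases \<alpha>)
  case (real r)
  then show ?thesis
    by (cases "0 \<le> r") (auto simp: init_seg_def ennreal_less_iff ennreal_neg)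
next
  case MInf
  then show ?thesis
    by (auto simp: init_seg_def e2ennreal_neg)
qed (auto simp: init_seg_top)

lemma space_I_meas: "space (I_meas \<alpha>) = init_seg (e2ennreal \<alpha>)"
  by (simp add: I_meas_def domain_eq_init_seg)

lemma sets_I_meas: "S \<in> sets (I_meas \<alpha>) \<longleftrightarrow> S \<subseteq> init_seg (e2ennreal \<alpha>) \<and> S \<in> sets lebesgue"
  unfolding I_meas_def domain_eq_init_seg
  by (subst sets_restrict_space_iff) (auto intro: sets_completionI_sets)

lemma emeasure_I_meas:
  "S \<subseteq> init_seg (e2ennreal \<alpha>) \<Longrightarrow> emeasure (I_meas \<alpha>) S = emeasure lebesgue S"
  unfolding I_meas_def domain_eq_init_seg
  by (subst emeasure_restrict_space) (auto intro: sets_completionI_sets)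

lemma AE_I_meas_iff:
  "(AE s in I_meas \<alpha>. P s) \<longleftrightarrow> (AE s in lebesgue. s \<in> init_seg (e2ennreal \<alpha>) \<longrightarrow> P s)"
  unfolding I_meas_def domain_eq_init_seg
  by (subst AE_restrict_space_iff) (auto intro: sets_completionI_sets)

section \<open>Countable exceptional sets and Helly selection\<close>

lemma AE_lebesgue_countable:
  assumes "countable A" "\<And>s. s \<notin> A \<Longrightarrow> P s"
  shows "AE s in lebesgue. P s"
proof -
  have "A \<in> null_sets lebesgue"
    using countable_imp_null_set_lborel[OF assms(1)] by (rule null_sets_completionI)
  then show ?thesis
    by (rule AE_I') (use assms(2) in auto)
qed

lemma AE_I_meas_pos: "AE s in I_meas \<alpha>. 0 < s"
  unfolding AE_I_meas_iff
  by (rule AE_lebesgue_countable[of "{0}"]) (auto simp: init_seg_def)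

text \<open>For \<open>s < t\<close> the interval from \<open>L t\<close> to \<open>U t\<close> lies
  below the one from \<open>L s\<close> to \<open>U s\<close>. Hence each rational lies strictly
  inside at most one of these intervals, while every nondegenerate one contains a rational.\<close>

lemma countable_gap:
  fixes L U :: "real \<Rightarrow> ereal"
  assumes "\<And>s t. s < t \<Longrightarrow> U t \<le> L s"
  shows "countable {t. L t < U t}"
proof -
  let ?B = "\<lambda>q::rat. {t. L t < ereal (of_rat q) \<and> ereal (of_rat q) < U t}"
  have "countable (?B q)" for q
  proof -
    have "s = t" if "s \<in> ?B q" "t \<in> ?B q" for s t
    proof (rule ccontr)
      assume "s \<noteq> t"
      then consider "s < t" | "t < s" by linarith
      then show False
        using assms[of s t] assms[of t s] that by cases auto
    qed
    then have "?B q = {} \<or> (\<exists>t. ?B q = {t})"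
      by blast
    then show ?thesis
      by (metis countable_empty countable_insert)
  qed
  then have "countable (\<Union>q. ?B q)"
    by simp
  moreover have "{t. L t < U t} \<subseteq> (\<Union>q. ?B q)"
  proof safe
    fix t assume "L t < U t"
    then obtain q :: rat where "L t < real_of_rat q" "real_of_rat q < U t"
      using ereal_dense3[of "L t" "U t"] by auto
    then show "t \<in> (\<Union>q. ?B q)" by blast
  qed
  ultimately show ?thesis
    by (rule countable_subset[rotated])
qed

text \<open>Compactness of \<open>ereal\<close> and a diagonal argument give convergence at all
  rationals. A rational between \<open>s\<close> and \<open>t\<close> then separates the limsup at
  \<open>t\<close> from the liminf at \<open>s\<close>, and \<open>countable_gap\<close> bounds the
  set where the two differ.\<close>

lemma ereal_Helly_antimono:
  fixes f :: "nat \<Rightarrow> real \<Rightarrow> ereal"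
  assumes anti: "\<And>n. antimono (f n)"
  obtains r where "strict_mono r"
    "countable {t. \<not> (\<lambda>n. f (r n) t) \<longlonglongrightarrow> liminf (\<lambda>n. f (r n) t)}"
proof -
  let ?P = "\<lambda>n s. convergent (\<lambda>k. f (s k) (real_of_rat (from_nat n)))"
  interpret nat: subseqs ?P
  proof
    fix n and s :: "nat \<Rightarrow> nat" assume "strict_mono s"
    show "\<exists>r'. strict_mono r' \<and> ?P n (s \<circ> r')"
      using compact_complete_linorder[of "\<lambda>k. f (s k) (real_of_rat (from_nat n))"]
      by (auto simp: convergent_def o_def)
  qed
  define r where "r = nat.diagseq"
  \<comment> \<open>The diagonal sequence is a subsequence of the \<open>n\<close>-th selected one
    only from some index on; dropping an initial segment does not affect convergence.\<close>
  have "?P n (r \<circ> (+) (Suc n))" for n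
    unfolding r_def
  proof (rule nat.diagseq_holds)
    show "?P k (s \<circ> r')" if "strict_mono r'" "?P k s" for r' s k
      using convergent_subseq_convergent[OF that(2,1)] by (simp add: o_def)
  qed
  from this[unfolded o_def] have conv: "?P n r" for n
    using convergent_ignore_initial_segment[of "\<lambda>k. f (r k) (real_of_rat (from_nat n))" "Suc n"]
    by (simp only: add.commute[of _ "Suc n"])
  have gap: "limsup (\<lambda>n. f (r n) t) \<le> liminf (\<lambda>n. f (r n) s)" if "s < t" for s t
  proof -
    obtain q where q: "s < real_of_rat q" "real_of_rat q < t"
      using of_rat_dense[OF \<open>s < t\<close>] by blast
    have "convergent (\<lambda>k. f (r k) (real_of_rat q))"
      using conv[of "to_nat q"] by simp
    then have eq: "limsup (\<lambda>k. f (r k) (real_of_rat q)) = liminf (\<lambda>k. f (r k) (real_of_rat q))"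
      by (metis convergent_def lim_imp_Liminf lim_imp_Limsup sequentially_bot)
    have "limsup (\<lambda>n. f (r n) t) \<le> limsup (\<lambda>k. f (r k) (real_of_rat q))"
      using q by (intro Limsup_mono always_eventually) (auto intro: antimonoD[OF anti])
    also have "\<dots> \<le> liminf (\<lambda>n. f (r n) s)"
      unfolding eq using q by (intro Liminf_mono always_eventually) (auto intro: antimonoD[OF anti])
    finally show ?thesis .
  qed
  show ?thesis
  proof
    show "strict_mono r"
      unfolding r_def by (rule nat.subseq_diagseq)
    have "{t. \<not> (\<lambda>n. f (r n) t) \<longlonglongrightarrow> liminf (\<lambda>n. f (r n) t)}
       \<subseteq> {t. liminf (\<lambda>n. f (r n) t) < limsup (\<lambda>n. f (r n) t)}"
      using Liminf_le_Limsup[of sequentially "\<lambda>n. f (r n) _"]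
      by (fastforce simp: tendsto_iff_Liminf_eq_Limsup order_less_le)
    then show "countable {t. \<not> (\<lambda>n. f (r n) t) \<longlonglongrightarrow> liminf (\<lambda>n. f (r n) t)}"
      using countable_gap[of "\<lambda>t. limsup (\<lambda>n. f (r n) t)" "\<lambda>t. liminf (\<lambda>n. f (r n) t)", OF gap]
      by (rule countable_subset)
  qed
qed

section \<open>Distribution functions\<close>

lemma level_set_sets:
  assumes "x \<in> L0 \<alpha>"
  shows "{s \<in> space (I_meas \<alpha>). l < \<bar>x s\<bar>} \<in> sets (I_meas \<alpha>)"
proof -
  have [measurable]: "x \<in> borel_measurable (I_meas \<alpha>)"
    using assms by (simp add: L0_def)
  show ?thesis by measurable
qed

lemma distr_fun_le_length: "distr_fun \<alpha> x l \<le> e2ennreal \<alpha>"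
proof -
  have "distr_fun \<alpha> x l \<le> emeasure (I_meas \<alpha>) (space (I_meas \<alpha>))"
    unfolding distr_fun_def by (rule emeasure_space)
  then show ?thesis
    by (simp add: space_I_meas emeasure_I_meas emeasure_init_seg)
qed

lemma distr_fun_neg:
  assumes "l < 0"
  shows "distr_fun \<alpha> x l = e2ennreal \<alpha>"
proof -
  have "{s \<in> space (I_meas \<alpha>). ereal l < \<bar>x s\<bar>} = init_seg (e2ennreal \<alpha>)"
    using assms by (auto simp: space_I_meas intro: less_le_trans[OF _ abs_ereal_pos])
  then show ?thesis
    by (simp add: distr_fun_def emeasure_I_meas emeasure_init_seg)
qed

lemma distr_fun_antimono:
  assumes "x \<in> L0 \<alpha>" "l \<le> l'"
  shows "distr_fun \<alpha> x l' \<le> distr_fun \<alpha> x l"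
  unfolding distr_fun_def
proof (intro emeasure_mono level_set_sets assms(1) subsetI)
  fix s assume "s \<in> {s \<in> space (I_meas \<alpha>). ereal l' < \<bar>x s\<bar>}"
  moreover have "ereal l \<le> ereal l'" using assms(2) by simp
  ultimately show "s \<in> {s \<in> space (I_meas \<alpha>). ereal l < \<bar>x s\<bar>}"
    using le_less_trans by blast
qed

lemma distr_fun_mono:
  assumes "y \<in> L0 \<alpha>" "AE s in I_meas \<alpha>. \<bar>x s\<bar> \<le> \<bar>y s\<bar>"
  shows "distr_fun \<alpha> x l \<le> distr_fun \<alpha> y l"
  unfolding distr_fun_def
proof (rule emeasure_mono_AE)
  show "AE s in I_meas \<alpha>. s \<in> {s \<in> space (I_meas \<alpha>). ereal l < \<bar>x s\<bar>} \<longrightarrow>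
      s \<in> {s \<in> space (I_meas \<alpha>). ereal l < \<bar>y s\<bar>}"
    using assms(2) by eventually_elim (auto intro: less_le_trans)
qed (rule level_set_sets[OF assms(1)])

text \<open>Right-continuity of the distribution function: the level sets at
  \<open>l + 1 / (n + 1)\<close> increase to the one at \<open>l\<close>, so continuity from below
  applies even when the measures are infinite.\<close>

lemma distr_fun_less_right:
  assumes "x \<in> L0 \<alpha>" "c < distr_fun \<alpha> x l"
  obtains l' where "l < l'" "c < distr_fun \<alpha> x l'"
proof -
  let ?A = "\<lambda>l. {s \<in> space (I_meas \<alpha>). ereal l < \<bar>x s\<bar>}"
  let ?l = "\<lambda>n. l + 1 / real (Suc n)"
  have "incseq (\<lambda>n. ?A (?l n))"
  proof (intro incseq_SucI subsetI)
    fix n s assume s: "s \<in> ?A (?l n)"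
    have "?l (Suc n) \<le> ?l n" by (simp add: frac_le)
    with s show "s \<in> ?A (?l (Suc n))"
      by (auto elim: le_less_trans[rotated])
  qed
  then have "(SUP n. distr_fun \<alpha> x (?l n)) = emeasure (I_meas \<alpha>) (\<Union>n. ?A (?l n))"
    unfolding distr_fun_def using level_set_sets[OF assms(1)] by (intro SUP_emeasure_incseq) auto
  also have "(\<Union>n. ?A (?l n)) = ?A l"
  proof safe
    fix n s assume "ereal (?l n) < \<bar>x s\<bar>"
    then show "ereal l < \<bar>x s\<bar>"
      by (rule le_less_trans[rotated]) simp
  next
    fix s assume s: "s \<in> space (I_meas \<alpha>)" "ereal l < \<bar>x s\<bar>"
    then obtain m where m: "ereal l < ereal m" "ereal m < \<bar>x s\<bar>"
      using ereal_dense2 by blast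
    then obtain n where "1 / real (Suc n) < m - l"
      using nat_approx_posE[of "m - l"] by auto
    then have "ereal (?l n) < \<bar>x s\<bar>"
      using m(2) by (intro less_trans[OF _ m(2)]) simp
    with s show "s \<in> (\<Union>n. ?A (?l n))" by blast
  qed
  finally have "c < (SUP n. distr_fun \<alpha> x (?l n))"
    using assms(2) by (simp add: distr_fun_def)
  then obtain n where "c < distr_fun \<alpha> x (?l n)"
    by (auto simp: less_SUP_iff)
  then show ?thesis
    by (intro that[of "?l n"]) auto
qed

section \<open>Decreasing rearrangements, in particular of decreasing functions\<close>

lemma decr_rearr_nonneg: "0 \<le> decr_rearr \<alpha> x t"
  unfolding decr_rearr_def by (rule Inf_greatest) auto

lemma decr_rearr_le:
  assumes "x \<in> L0 \<alpha>" "0 \<le> l" "distr_fun \<alpha> x l \<le> ennreal t"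
  shows "decr_rearr \<alpha> x t \<le> ereal l"
proof (cases "l = 0")
  case False
  with assms show ?thesis
    unfolding decr_rearr_def by (intro Inf_lower) auto
next
  \<comment> \<open>The infimum in the definition ranges over positive levels only, so level
    \<open>0\<close> is approached by small \<open>e > 0\<close>.\<close>
  case True
  show ?thesis
  proof (rule ereal_le_epsilon2)
    fix e :: real assume "0 < e"
    then have "distr_fun \<alpha> x e \<le> ennreal t"
      using distr_fun_antimono[OF assms(1), of 0 e] assms(3) True by simp
    then have "decr_rearr \<alpha> x t \<le> ereal e"
      unfolding decr_rearr_def using \<open>0 < e\<close> by (intro Inf_lower) auto
    then show "decr_rearr \<alpha> x t \<le> ereal l + ereal e"
      using True by simp
  qed
qed

lemma less_decr_rearr_iff:
  assumes "x \<in> L0 \<alpha>" "0 \<le> l"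
  shows "ereal l < decr_rearr \<alpha> x t \<longleftrightarrow> ennreal t < distr_fun \<alpha> x l"
proof
  show "ennreal t < distr_fun \<alpha> x l" if "ereal l < decr_rearr \<alpha> x t"
    using decr_rearr_le[OF assms, of t] that by (meson leD leI)
  assume "ennreal t < distr_fun \<alpha> x l"
  then obtain l' where l': "l < l'" "ennreal t < distr_fun \<alpha> x l'"
    using distr_fun_less_right[OF assms(1)] by blast
  have "ereal l' \<le> decr_rearr \<alpha> x t"
    unfolding decr_rearr_def
  proof (rule Inf_greatest, clarify)
    fix m assume m: "0 < m" "distr_fun \<alpha> x m \<le> ennreal t"
    have "\<not> m \<le> l'"
      using distr_fun_antimono[OF assms(1), of m l'] m l' by auto
    then show "ereal l' \<le> ereal m" by simp
  qed
  with l' show "ereal l < decr_rearr \<alpha> x t"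
    by (metis ereal_less_eq(3) less_eq_ereal_def less_ereal.simps(1) less_le_trans)
qed

lemma decr_rearr_antimono: "antimono (decr_rearr \<alpha> x)"
  unfolding decr_rearr_def
  by (intro antimonoI Inf_superset_mono) (auto dest: order_trans[OF _ ennreal_leI])

lemma decr_rearr_mono:
  assumes "y \<in> L0 \<alpha>" "AE s in I_meas \<alpha>. \<bar>x s\<bar> \<le> \<bar>y s\<bar>"
  shows "decr_rearr \<alpha> x t \<le> decr_rearr \<alpha> y t"
  unfolding decr_rearr_def
  using order_trans[OF distr_fun_mono[OF assms]] by (intro Inf_superset_mono) blast

lemma decr_rearr_outside:
  assumes "x \<in> L0 \<alpha>" "e2ennreal \<alpha> \<le> ennreal t"
  shows "decr_rearr \<alpha> x t = 0"
proof -
  have "decr_rearr \<alpha> x t \<le> ereal 0"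
    by (rule decr_rearr_le[OF assms(1) order_refl order_trans[OF distr_fun_le_length assms(2)]])
  then show ?thesis
    using decr_rearr_nonneg[of \<alpha> x t] by (simp add: zero_ereal_def[symmetric])
qed

lemma antimono_ereal_borel_measurable:
  fixes f :: "real \<Rightarrow> ereal"
  assumes "antimono f"
  shows "f \<in> borel_measurable borel"
proof (rule borel_measurableI_greater)
  fix c
  have "is_interval {s. c < f s}"
    unfolding is_interval_1 using antimonoD[OF assms] by (auto elim: less_le_trans)
  then show "{s \<in> space borel. c < f s} \<in> sets borel"
    by (simp add: real_interval_borel_measurable)
qed

lemma borel_measurable_decr_rearr [measurable]: "decr_rearr \<alpha> x \<in> borel_measurable borel"
  by (rule antimono_ereal_borel_measurable[OF decr_rearr_antimono])

lemma borel_imp_L0: "f \<in> borel_measurable borel \<Longrightarrow> f \<in> L0 \<alpha>"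
  unfolding L0_def I_meas_def
  by (intro measurable_restrict_space1 measurable_completion) simp

lemma decr_rearr_L0: "decr_rearr \<alpha> x \<in> L0 \<alpha>"
  by (simp add: borel_imp_L0)

text \<open>By \<open>less_decr_rearr_iff\<close>, the superlevel set at \<open>l \<ge> 0\<close> is
  the initial segment of length \<open>distr_fun \<alpha> x l\<close>, which fits inside the domain.
  For \<open>l < 0\<close> both sides are the full length.\<close>

lemma distr_fun_decr_rearr:
  assumes "x \<in> L0 \<alpha>"
  shows "distr_fun \<alpha> (decr_rearr \<alpha> x) = distr_fun \<alpha> x"
proof
  fix l
  show "distr_fun \<alpha> (decr_rearr \<alpha> x) l = distr_fun \<alpha> x l"
  proof (cases "l < 0")
    case False
    have "{s \<in> space (I_meas \<alpha>). ereal l < \<bar>decr_rearr \<alpha> x s\<bar>} =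
        init_seg (e2ennreal \<alpha>) \<inter> init_seg (distr_fun \<alpha> x l)"
      using False less_decr_rearr_iff[OF assms, of l]
      by (auto simp: space_I_meas init_seg_def decr_rearr_nonneg)
    also have "\<dots> = init_seg (distr_fun \<alpha> x l)"
      by (simp add: init_seg_Int min_absorb2 distr_fun_le_length)
    finally have eq: "{s \<in> space (I_meas \<alpha>). ereal l < \<bar>decr_rearr \<alpha> x s\<bar>} =
        init_seg (distr_fun \<alpha> x l)" .
    moreover have "init_seg (distr_fun \<alpha> x l) \<subseteq> init_seg (e2ennreal \<alpha>)"
      using distr_fun_le_length[of \<alpha> x l] by (auto simp: init_seg_def)
    ultimately show ?thesis
      by (subst distr_fun_def) (simp add: emeasure_I_meas emeasure_init_seg)
  qed (simp add: distr_fun_neg)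
qed

lemma decr_rearr_idem: "x \<in> L0 \<alpha> \<Longrightarrow> decr_rearr \<alpha> (decr_rearr \<alpha> x) = decr_rearr \<alpha> x"
  by (simp add: decr_rearr_def fun_eq_iff distr_fun_decr_rearr)

text \<open>A decreasing \<open>y\<close> can exceed the level \<open>y t\<close> only to the left
  of \<open>t\<close>, that is, on a set of measure at most \<open>t\<close>.\<close>

lemma decr_rearr_antimono_fun_le:
  assumes y: "antimono y" "\<And>s. 0 \<le> y s" and t: "0 \<le> t"
  shows "decr_rearr \<alpha> y t \<le> y t"
proof (cases "y t")
  case (real l)
  with y(2)[of t] have l: "0 \<le> l" by simp
  have "{s \<in> space (I_meas \<alpha>). ereal l < \<bar>y s\<bar>} \<subseteq> init_seg (ennreal t)"
  proof
    fix s assume s: "s \<in> {s \<in> space (I_meas \<alpha>). ereal l < \<bar>y s\<bar>}"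
    then have "\<not> t \<le> s"
      using antimonoD[OF y(1), of t s] real y(2)[of s] by auto
    with s show "s \<in> init_seg (ennreal t)"
      by (auto simp: space_I_meas init_seg_def ennreal_less_iff)
  qed
  then have "emeasure lebesgue {s \<in> space (I_meas \<alpha>). ereal l < \<bar>y s\<bar>} \<le> ennreal t"
    using emeasure_mono[of _ "init_seg (ennreal t)" lebesgue] by (simp add: emeasure_init_seg)
  then have "distr_fun \<alpha> y l \<le> ennreal t"
    unfolding distr_fun_def by (subst emeasure_I_meas) (auto simp: space_I_meas)
  then show ?thesis
    using decr_rearr_le[OF borel_imp_L0[OF antimono_ereal_borel_measurable[OF y(1)]] l] real by simp
qed (use y(2)[of t] in auto)

text \<open>Any level below \<open>y t\<close> is exceeded on all of \<open>{0..<t}\<close>, so its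
  distribution value is at least \<open>t\<close>, hence greater than \<open>s\<close>.\<close>

lemma decr_rearr_antimono_fun_ge:
  assumes y: "antimono y" "\<And>s. 0 \<le> y s" and t: "s < t" "0 < t" "t \<in> init_seg (e2ennreal \<alpha>)"
  shows "y t \<le> decr_rearr \<alpha> y s"
proof (rule ccontr)
  assume "\<not> ?thesis"
  then obtain l where l: "decr_rearr \<alpha> y s < ereal l" "ereal l < y t"
    using ereal_dense2[of "decr_rearr \<alpha> y s" "y t"] by (auto simp: not_le)
  have "0 \<le> l"
    using decr_rearr_nonneg[of \<alpha> y s] l(1) by (metis ereal_less_eq(5) less_imp_le order_trans)
  have L0: "y \<in> L0 \<alpha>"
    by (rule borel_imp_L0[OF antimono_ereal_borel_measurable[OF y(1)]])
  have sub: "init_seg (ennreal t) \<subseteq> init_seg (e2ennreal \<alpha>)"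
    using t(3) by (auto simp: init_seg_def)
  have "ennreal s < ennreal t"
    using t by (simp add: ennreal_lessI)
  also have "ennreal t = emeasure (I_meas \<alpha>) (init_seg (ennreal t))"
    using sub by (simp add: emeasure_I_meas emeasure_init_seg)
  also have "\<dots> \<le> distr_fun \<alpha> y l"
    unfolding distr_fun_def
  proof (intro emeasure_mono level_set_sets L0 subsetI)
    fix u assume u: "u \<in> init_seg (ennreal t)"
    then have "u \<le> t"
      using t by (auto simp: init_seg_def ennreal_less_iff)
    then have "ereal l < y u"
      using l(2) antimonoD[OF y(1)] by (meson less_le_trans)
    with u sub show "u \<in> {s \<in> space (I_meas \<alpha>). ereal l < \<bar>y s\<bar>}"
      using y(2)[of u] by (auto simp: space_I_meas)
  qed
  finally show False
    using less_decr_rearr_iff[OF L0 \<open>0 \<le> l\<close>, of s] l(1) by auto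
qed

text \<open>The two preceding bounds leave room for a difference only at the jumps of
  \<open>y\<close>, and \<open>countable_gap\<close> shows that these are countably many.\<close>

lemma AE_decr_rearr_antimono_fun:
  assumes y: "antimono y" "\<And>s. 0 \<le> y s"
  shows "AE t in I_meas \<alpha>. decr_rearr \<alpha> y t = y t"
proof -
  \<comment> \<open>Truncation to \<open>0\<close> makes the hypothesis of
    \<open>countable_gap\<close> hold for all real \<open>s < t\<close>, including points outside
    the domain.\<close>
  let ?U = "\<lambda>t. if 0 < t \<and> t \<in> init_seg (e2ennreal \<alpha>) then y t else 0"
  have "countable {t. decr_rearr \<alpha> y t < ?U t}"
    using decr_rearr_antimono_fun_ge[OF y] decr_rearr_nonneg by (intro countable_gap) auto
  then have "AE t in I_meas \<alpha>. \<not> decr_rearr \<alpha> y t < ?U t"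
    unfolding AE_I_meas_iff by (rule AE_lebesgue_countable) auto
  moreover have "AE t in I_meas \<alpha>. 0 < t \<and> t \<in> init_seg (e2ennreal \<alpha>)"
    using AE_I_meas_pos AE_space by eventually_elim (simp add: space_I_meas)
  ultimately show ?thesis
  proof eventually_elim
    case (elim t)
    then show ?case
      using decr_rearr_antimono_fun_le[OF y, of t \<alpha>] by (auto intro: antisym)
  qed
qed

section \<open>Majorization, tails at infinity and null sequences\<close>

abbreviation rearr_integral :: "ereal \<Rightarrow> (real \<Rightarrow> ereal) \<Rightarrow> real \<Rightarrow> ennreal" where
  "rearr_integral \<alpha> x t \<equiv> \<integral>\<^sup>+ s\<in>{0..t}. e2ennreal (decr_rearr \<alpha> x s) \<partial>lebesgue"

lemma hlp_le_iff: "hlp_le \<alpha> y x \<longleftrightarrow> (\<forall>t>0. rearr_integral \<alpha> y t \<le> rearr_integral \<alpha> x t)"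
proof -
  have "a / ennreal t \<le> b / ennreal t \<longleftrightarrow> a \<le> b" if "0 < t" for a b t
  proof
    have eq: "c / ennreal t * ennreal t = c" for c
      using that by (simp add: ennreal_divide_times ennreal_divide_self ennreal_times_divide[symmetric])
    show "a \<le> b" if "a / ennreal t \<le> b / ennreal t"
      using mult_right_mono[OF that, of "ennreal t"] by (simp add: eq)
  qed (rule divide_right_mono_ennreal)
  then show ?thesis
    by (auto simp: hlp_le_def maximal_fun_def)
qed

lemma rearr_integral_mono:
  assumes "AE s in lebesgue. 0 \<le> s \<longrightarrow> decr_rearr \<alpha> y s \<le> decr_rearr \<beta> z s"
  shows "rearr_integral \<alpha> y t \<le> rearr_integral \<beta> z t"
proof (rule nn_integral_mono_AE)
  show "AE s in lebesgue. e2ennreal (decr_rearr \<alpha> y s) * indicator {0..t} s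
      \<le> e2ennreal (decr_rearr \<beta> z s) * indicator {0..t} s"
    using assms by eventually_elim (auto simp: indicator_def intro: e2ennreal_mono)
qed

lemma hlp_le_refl: "hlp_le \<alpha> x x"
  by (simp add: hlp_le_def)

text \<open>Rearranging both sides of the domination and using idempotence puts
  \<open>decr_rearr \<alpha> y\<close> below \<open>decr_rearr \<alpha> z\<close> pointwise.\<close>

lemma hlp_le_dominated:
  assumes "hlp_le \<alpha> z x" "z \<in> L0 \<alpha>" "AE s in I_meas \<alpha>. \<bar>y s\<bar> \<le> decr_rearr \<alpha> z s"
  shows "hlp_le \<alpha> y x"
proof -
  have "decr_rearr \<alpha> y s \<le> decr_rearr \<alpha> z s" for s
    using decr_rearr_mono[OF decr_rearr_L0[of \<alpha> z], of y s] assms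
    by (simp add: decr_rearr_nonneg decr_rearr_idem)
  then have "rearr_integral \<alpha> y t \<le> rearr_integral \<alpha> z t" for t
    by (intro rearr_integral_mono) simp
  then show ?thesis
    using assms(1) unfolding hlp_le_iff by (blast intro: order_trans)
qed

text \<open>On \<open>{0..t}\<close> the rearrangement is at least its value at \<open>t\<close>.
  For negative \<open>t\<close> the left side is \<open>0\<close>.\<close>

lemma decr_rearr_le_integral: "ennreal t * e2ennreal (decr_rearr \<alpha> y t) \<le> rearr_integral \<alpha> y t"
proof (cases "0 \<le> t")
  case True
  have "ennreal t * e2ennreal (decr_rearr \<alpha> y t) =
      (\<integral>\<^sup>+ s. e2ennreal (decr_rearr \<alpha> y t) * indicator {0..t} s \<partial>lebesgue)"
    using True by (subst nn_integral_cmult_indicator) (auto simp: mult.commute emeasure_completion)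
  also have "\<dots> \<le> rearr_integral \<alpha> y t"
    by (intro nn_integral_mono)
      (auto simp: indicator_def intro!: e2ennreal_mono antimonoD[OF decr_rearr_antimono])
  finally show ?thesis .
qed (simp add: ennreal_neg)

text \<open>For \<alpha> = 1 the rearrangement vanishes from \<open>1\<close> on. For \<alpha> =
  \<infinity> monotonicity makes the infimum an actual limit, which gives the value of
  \<open>Lim\<close> its meaning.\<close>

lemma decr_rearr_tendsto_infty:
  assumes "\<alpha> = 1 \<or> \<alpha> = \<infinity>" "x \<in> L0 \<alpha>" "decr_rearr_infty \<alpha> x = 0"
  shows "(decr_rearr \<alpha> x \<longlongrightarrow> 0) at_top"
  using assms(1)
proof
  assume \<alpha>: "\<alpha> = 1"
  have "decr_rearr \<alpha> x t = 0" if "1 \<le> t" for t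
  proof (rule decr_rearr_outside[OF assms(2)])
    have "e2ennreal \<alpha> = ennreal 1"
      unfolding \<alpha> one_ereal_def by (rule e2ennreal_ereal)
    then show "e2ennreal \<alpha> \<le> ennreal t"
      using that by (metis ennreal_leI)
  qed
  then show ?thesis
    by (intro tendsto_eventually) (auto simp: eventually_at_top_linorder)
next
  assume \<alpha>: "\<alpha> = \<infinity>"
  let ?l = "INF t. decr_rearr \<alpha> x t"
  have lim: "(decr_rearr \<alpha> x \<longlongrightarrow> ?l) at_top"
  proof (rule order_tendstoI)
    show "eventually (\<lambda>t. a < decr_rearr \<alpha> x t) at_top" if "a < ?l" for a
      using that by (intro always_eventually) (auto intro: less_le_trans INF_lower)
  next
    fix a assume "?l < a"
    then obtain T where "decr_rearr \<alpha> x T < a"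
      by (auto simp: INF_less_iff)
    then have "decr_rearr \<alpha> x t < a" if "T \<le> t" for t
      using antimonoD[OF decr_rearr_antimono that, of \<alpha> x] by (meson le_less_trans)
    then show "eventually (\<lambda>t. decr_rearr \<alpha> x t < a) at_top"
      by (auto simp: eventually_at_top_linorder)
  qed
  then have "?l = 0"
    using assms(3) \<alpha> tendsto_Lim[OF _ lim] by (simp add: decr_rearr_infty_def)
  with lim show ?thesis by simp
qed

lemma distr_fun_double: "distr_fun \<alpha> (\<lambda>s. ereal 2 * x s) l = distr_fun \<alpha> x (l / 2)"
proof -
  have "ereal l < \<bar>ereal 2 * x s\<bar> \<longleftrightarrow> ereal (l / 2) < \<bar>x s\<bar>" for s
    by (cases "x s") auto
  then show ?thesis
    by (simp add: distr_fun_def)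
qed

text \<open>The interval \<open>{0..t}\<close> is covered by \<open>{0..T}\<close> and a part on
  which the integrand is at most \<open>e\<close>; \<open>T\<close> and \<open>t\<close> may come in
  either order.\<close>

lemma rearr_integral_le_add:
  assumes "0 \<le> e" "\<And>s. T \<le> s \<Longrightarrow> decr_rearr \<alpha> x s \<le> ereal e" "0 \<le> t"
  shows "rearr_integral \<alpha> x t \<le> rearr_integral \<alpha> x T + ennreal (e * t)"
proof -
  have meas: "(\<lambda>s. e2ennreal (decr_rearr \<alpha> x s) * indicator {0..T} s) \<in> borel_measurable lebesgue"
    by (intro measurable_completion) measurable
  have "rearr_integral \<alpha> x t \<le>
      (\<integral>\<^sup>+ s. e2ennreal (decr_rearr \<alpha> x s) * indicator {0..T} s + ennreal e * indicator {0..t} s \<partial>lebesgue)"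
  proof (rule nn_integral_mono)
    fix s
    have "e2ennreal (decr_rearr \<alpha> x s) \<le> ennreal e" if "T \<le> s"
      using e2ennreal_mono[OF assms(2)[OF that]] by simp
    then show "e2ennreal (decr_rearr \<alpha> x s) * indicator {0..t} s \<le>
        e2ennreal (decr_rearr \<alpha> x s) * indicator {0..T} s + ennreal e * indicator {0..t} s"
      by (auto simp: indicator_def)
  qed
  also have "\<dots> = rearr_integral \<alpha> x T + (\<integral>\<^sup>+ s. ennreal e * indicator {0..t} s \<partial>lebesgue)"
    by (intro nn_integral_add meas measurable_completion) measurable
  also have "(\<integral>\<^sup>+ s. ennreal e * indicator {0..t} s \<partial>lebesgue) = ennreal (e * t)"
    using assms by (simp add: nn_integral_cmult_indicator emeasure_completion ennreal_mult)
  finally show ?thesis .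
qed

text \<open>Let the rearrangement of \<open>x\<close> be below \<open>e / 2\<close> from
  \<open>T\<close> on and have integral \<open>C\<close> up to \<open>T\<close>. If that of
  \<open>y\<close> exceeds \<open>e\<close> at \<open>t\<close>, then
  \<open>t * e \<le> C + e / 2 * t\<close>, so \<open>t \<le> 2 * C / e\<close>. This bound serves
  as \<open>K\<close> and does not depend on \<open>y\<close>.\<close>

lemma hlp_le_uniform_tail:
  assumes lim: "(decr_rearr \<alpha> x \<longlongrightarrow> 0) at_top"
    and fin: "\<And>t. rearr_integral \<alpha> x t < top"
    and e: "0 < e"
  obtains K where "\<And>y t. hlp_le \<alpha> y x \<Longrightarrow> K < t \<Longrightarrow> decr_rearr \<alpha> y t \<le> ereal e"
proof -
  have "eventually (\<lambda>t. decr_rearr \<alpha> x t < ereal (e / 2)) at_top"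
    using e by (intro order_tendstoD(2)[OF lim]) simp
  then obtain T where T: "\<And>t. T \<le> t \<Longrightarrow> decr_rearr \<alpha> x t < ereal (e / 2)"
    by (auto simp: eventually_at_top_linorder)
  obtain C where C: "0 \<le> C" "rearr_integral \<alpha> x T = ennreal C"
    using fin[of T] by (metis ennreal_cases less_irrefl)
  show ?thesis
  proof
    fix y t assume y: "hlp_le \<alpha> y x" and t: "2 * C / e < t"
    have pos: "0 < t"
      using t C(1) e by (meson divide_nonneg_pos le_less_trans mult_nonneg_nonneg zero_le_numeral)
    show "decr_rearr \<alpha> y t \<le> ereal e"
    proof (rule ccontr)
      assume "\<not> ?thesis"
      then have "ennreal e \<le> e2ennreal (decr_rearr \<alpha> y t)"
        using e2ennreal_mono[of "ereal e" "decr_rearr \<alpha> y t"] by simp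
      then have "ennreal (t * e) \<le> ennreal t * e2ennreal (decr_rearr \<alpha> y t)"
        using pos e by (simp add: ennreal_mult mult_left_mono)
      also have "\<dots> \<le> rearr_integral \<alpha> y t"
        by (rule decr_rearr_le_integral)
      also have "\<dots> \<le> rearr_integral \<alpha> x t"
        using y pos by (simp add: hlp_le_iff)
      also have "\<dots> \<le> rearr_integral \<alpha> x T + ennreal (e / 2 * t)"
        using e pos less_imp_le[OF T] by (intro rearr_integral_le_add) auto
      also have "\<dots> = ennreal (C + e / 2 * t)"
        using C e pos by simp
      finally have "t * e \<le> C + e / 2 * t"
        using C e pos by (simp del: ennreal_plus)
      with t e show False
        by (simp add: field_simps)
    qed
  qed
qed

text \<open>The tail hypothesis confines the level sets at \<open>e\<close>, up to null sets, to one
  set of finite measure. Dominated convergence of their indicators then gives convergence to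
  \<open>0\<close> in measure. Without such confinement, translates of an indicator function running
  off to infinity would tend to \<open>0\<close> with unchanged rearrangements.\<close>

lemma decr_rearr_tendsto_0:
  assumes L0: "\<And>n. f n \<in> L0 \<alpha>"
    and lim: "AE s in I_meas \<alpha>. (\<lambda>n. f n s) \<longlonglongrightarrow> 0"
    and tail: "\<And>e. 0 < e \<Longrightarrow> \<exists>K. \<forall>n. AE s in I_meas \<alpha>. K < s \<longrightarrow> \<bar>f n s\<bar> \<le> ereal e"
    and t: "0 < t"
  shows "(\<lambda>n. decr_rearr \<alpha> (f n) t) \<longlonglongrightarrow> 0"
proof (rule order_tendstoI)
  show "eventually (\<lambda>n. a < decr_rearr \<alpha> (f n) t) sequentially" if "a < 0" for a
    using that decr_rearr_nonneg by (intro always_eventually) (auto intro: less_le_trans)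
next
  fix a :: ereal assume "0 < a"
  then obtain e where e: "0 < e" "ereal e < a"
    using ereal_dense2[of 0 a] by (auto simp: zero_ereal_def)
  obtain K where K: "\<And>n. AE s in I_meas \<alpha>. K < s \<longrightarrow> \<bar>f n s\<bar> \<le> ereal e"
    using tail[OF e(1)] by blast
  let ?A = "\<lambda>n. {s \<in> space (I_meas \<alpha>). ereal e < \<bar>f n s\<bar>}"
  let ?W = "init_seg (e2ennreal \<alpha>) \<inter> {..K}"
  have W: "?W \<in> sets (I_meas \<alpha>)"
    by (auto simp: sets_I_meas intro: sets_completionI_sets)
  have "emeasure (I_meas \<alpha>) ?W \<le> emeasure lebesgue {0..max 0 K}"
    by (subst emeasure_I_meas) (auto simp del: emeasure_completion simp: init_seg_def intro!: emeasure_mono)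
  also have "\<dots> < top"
    by (simp add: emeasure_completion ennreal_less_top)
  finally have W_fin: "emeasure (I_meas \<alpha>) ?W < top" .
  have "(\<lambda>n. \<integral>\<^sup>+ s. indicator (?A n) s \<partial>I_meas \<alpha>) \<longlonglongrightarrow> (\<integral>\<^sup>+ s. 0 \<partial>I_meas \<alpha>)"
  proof (rule nn_integral_dominated_convergence)
    show "(\<integral>\<^sup>+ s. indicator ?W s \<partial>I_meas \<alpha>) < \<infinity>"
      using W W_fin by simp
    show "AE s in I_meas \<alpha>. (indicator (?A n) s :: ennreal) \<le> indicator ?W s" for n
      using K[of n] AE_space
      by eventually_elim (auto simp: indicator_def space_I_meas not_less[symmetric])
    show "AE s in I_meas \<alpha>. (\<lambda>n. indicator (?A n) s :: ennreal) \<longlonglongrightarrow> 0"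
      using lim
    proof eventually_elim
      case (elim s)
      have "0 < ereal e"
        using e(1) by simp
      moreover have "(\<lambda>n. \<bar>f n s\<bar>) \<longlonglongrightarrow> 0"
        using tendsto_abs_ereal[OF elim] by simp
      ultimately have "eventually (\<lambda>n. \<bar>f n s\<bar> < ereal e) sequentially"
        by (rule order_tendstoD(2)[rotated])
      then show ?case
        by (intro tendsto_eventually, eventually_elim) (auto simp: indicator_def)
    qed
  qed (use level_set_sets[OF L0] W in auto)
  then have "(\<lambda>n. distr_fun \<alpha> (f n) e) \<longlonglongrightarrow> 0"
    using level_set_sets[OF L0] by (simp add: distr_fun_def)
  moreover have "0 < ennreal t"
    using t by simp
  ultimately have "eventually (\<lambda>n. distr_fun \<alpha> (f n) e < ennreal t) sequentially"
    by (rule order_tendstoD(2))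
  then show "eventually (\<lambda>n. decr_rearr \<alpha> (f n) t < a) sequentially"
  proof eventually_elim
    case (elim n)
    then have "decr_rearr \<alpha> (f n) t \<le> ereal e"
      using e by (intro decr_rearr_le L0) auto
    with e(2) show ?case by simp
  qed
qed

section \<open>Finiteness and norm convergence in a symmetric space\<close>

context symmetric_space
begin

lemma mem_L0: "x \<in> E \<Longrightarrow> x \<in> L0 \<alpha>"
  using subset_L0 by blast

lemma decr_rearr_mem: "x \<in> E \<Longrightarrow> decr_rearr \<alpha> x \<in> E"
  and norm_decr_rearr: "x \<in> E \<Longrightarrow> N (decr_rearr \<alpha> x) = N x"
  using symmetric[OF decr_rearr_L0, of x x] distr_fun_decr_rearr[OF mem_L0] by auto

text \<open>Monotonicity would spread an infinite value at \<open>t\<close> over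
  \<open>{0..<t}\<close>, a part of the domain with positive measure, against finiteness
  a.e.\<close>

lemma decr_rearr_finite:
  assumes "x \<in> E" "0 < t"
  shows "decr_rearr \<alpha> x t < \<infinity>"
proof (rule ccontr)
  assume "\<not> ?thesis"
  then have inf: "decr_rearr \<alpha> x t = \<infinity>" by simp
  then have t: "ennreal t < e2ennreal \<alpha>"
    using decr_rearr_outside[OF mem_L0[OF assms(1)], of t] by (auto simp: not_less[symmetric])
  have "AE s in lebesgue. s \<in> init_seg (e2ennreal \<alpha>) \<longrightarrow> \<bar>decr_rearr \<alpha> x s\<bar> < \<infinity>"
    using finite_AE[OF decr_rearr_mem[OF assms(1)]] by (simp add: AE_I_meas_iff)
  then have "AE s in lebesgue. s \<notin> init_seg (ennreal t)"
  proof eventually_elim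
    case (elim s)
    show ?case
    proof
      assume s: "s \<in> init_seg (ennreal t)"
      then have "s \<le> t"
        using assms(2) by (auto simp: init_seg_def ennreal_less_iff)
      moreover have "s \<in> init_seg (e2ennreal \<alpha>)"
        using s t less_trans by (auto simp: init_seg_def)
      ultimately show False
        using antimonoD[OF decr_rearr_antimono, of s t \<alpha> x] inf elim by auto
    qed
  qed
  then have "init_seg (ennreal t) \<in> null_sets lebesgue"
    by (subst (asm) AE_iff_null_sets[symmetric]) (auto intro: sets_completionI_sets)
  then have "ennreal t = 0"
    using emeasure_init_seg[of "ennreal t"] by (simp add: null_setsD1)
  with assms(2) show False by simp
qed

text \<open>If the integral were infinite for one \<open>t\<close>, it would be so for all \<open>t\<close>, and every
  element of the space, in particular \<open>2x\<close>, would be majorized by \<open>x\<close>.\<close>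

lemma LKM_point_rearr_integral_finite:
  assumes LKM: "LKM_point \<alpha> E N x" and lim: "(decr_rearr \<alpha> x \<longlongrightarrow> 0) at_top"
  shows "rearr_integral \<alpha> x t < top"
proof (rule ccontr)
  assume "\<not> ?thesis"
  then have inf_t: "rearr_integral \<alpha> x t = top"
    by (simp add: not_less top_unique)
  have x: "x \<in> E"
    using LKM by (simp add: LKM_point_def)
  \<comment> \<open>Beyond \<open>u\<close> the rearrangement is bounded by its finite value at
    \<open>u\<close>, so the divergence already occurs near \<open>0\<close>.\<close>
  have inf: "rearr_integral \<alpha> x u = top" if u: "0 < u" for u
  proof -
    obtain e where e: "decr_rearr \<alpha> x u = ereal e" "0 \<le> e"
      using decr_rearr_finite[OF x u] decr_rearr_nonneg[of \<alpha> x u]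
      by (cases "decr_rearr \<alpha> x u") auto
    have "rearr_integral \<alpha> x t \<le> rearr_integral \<alpha> x (max 0 t)"
      by (intro nn_integral_mono) (auto simp: indicator_def)
    also have "\<dots> \<le> rearr_integral \<alpha> x u + ennreal (e * max 0 t)"
      using e antimonoD[OF decr_rearr_antimono, of u _ \<alpha> x]
      by (intro rearr_integral_le_add) auto
    finally show ?thesis
      using inf_t by (simp add: top_unique)
  qed
  let ?y = "\<lambda>s. ereal 2 * x s"
  have "?y \<in> E" "N ?y = 2 * N x"
    using scale_mem[OF x] norm_scale[OF x, of 2] by auto
  moreover have "hlp_le \<alpha> ?y x"
    by (simp add: hlp_le_iff inf)
  \<comment> \<open>Since \<open>2 * N x < N x\<close> is impossible, the LKM property leaves only
    equal rearrangements.\<close>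
  ultimately have eq: "decr_rearr \<alpha> x = decr_rearr \<alpha> ?y"
    using LKM norm_nonneg[OF x] unfolding LKM_point_def by fastforce
  \<comment> \<open>A positive value \<open>c\<close> would be strictly exceeded by the
    rearrangement of \<open>2x\<close> at \<open>u\<close>, because the distribution function of
    \<open>2x\<close> at \<open>c\<close> is that of \<open>x\<close> at \<open>c / 2\<close>. A
    rearrangement vanishing for \<open>u > 0\<close> cannot have an infinite integral.\<close>
  have "decr_rearr \<alpha> x u = 0" if u: "0 < u" for u
  proof (rule ccontr)
    assume "decr_rearr \<alpha> x u \<noteq> 0"
    then obtain c where c: "decr_rearr \<alpha> x u = ereal c" "0 < c"
      using decr_rearr_finite[OF x u] decr_rearr_nonneg[of \<alpha> x u]
      by (cases "decr_rearr \<alpha> x u") (auto simp: zero_ereal_def)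
    then have "ennreal u < distr_fun \<alpha> x (c / 2)"
      by (subst less_decr_rearr_iff[OF mem_L0[OF x], symmetric]) auto
    then have "ereal c < decr_rearr \<alpha> ?y u"
      using c less_decr_rearr_iff[OF mem_L0[OF \<open>?y \<in> E\<close>], of c u]
      by (simp add: distr_fun_double)
    with eq c show False by simp
  qed
  then have "rearr_integral \<alpha> x t = (\<integral>\<^sup>+ s. 0 \<partial>(lebesgue :: real measure))"
    by (intro nn_integral_cong_AE AE_lebesgue_countable[of "{0}"])
      (auto simp: indicator_def e2ennreal_neg)
  with inf_t show False by simp
qed

text \<open>The majorants \<open>z n\<close> have a common tail bound, which passes to
  \<open>f n\<close> and turns a.e. convergence into convergence of the rearrangements. Letting
  \<open>z\<close> vary with \<open>n\<close> covers both uses: positive parts bounded by the given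
  sequence, and negative parts bounded by \<open>x\<close> itself.\<close>

lemma K_order_continuity_point_tendsto_0:
  assumes K: "K_order_continuity_point \<alpha> E N x"
    and lim: "(decr_rearr \<alpha> x \<longlongrightarrow> 0) at_top"
    and fin: "\<And>t. rearr_integral \<alpha> x t < top"
    and z: "\<And>n. z n \<in> E" "\<And>n. hlp_le \<alpha> (z n) x"
    and f: "\<And>n. f n \<in> L0 \<alpha>" "\<And>n. AE s in I_meas \<alpha>. \<bar>f n s\<bar> \<le> decr_rearr \<alpha> (z n) s"
    and f0: "AE s in I_meas \<alpha>. (\<lambda>n. f n s) \<longlonglongrightarrow> 0"
  shows "f n \<in> E" "(\<lambda>n. N (f n)) \<longlonglongrightarrow> 0"
proof -
  show mem: "f n \<in> E" for n
    using ideal[OF f(1)[of n] decr_rearr_mem[OF z(1)[of n]]] f(2)[of n]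
    by (simp add: decr_rearr_nonneg)
  have "hlp_le \<alpha> (f n) x" for n
    by (rule hlp_le_dominated[OF z(2) mem_L0[OF z(1)] f(2)])
  moreover have "AE t in I_meas \<alpha>. (\<lambda>n. decr_rearr \<alpha> (f n) t) \<longlonglongrightarrow> 0"
    using AE_I_meas_pos
  proof eventually_elim
    case (elim t)
    show ?case
    proof (rule decr_rearr_tendsto_0[OF f(1) f0 _ elim])
      fix e :: real assume "0 < e"
      then obtain M where M: "\<And>y t. hlp_le \<alpha> y x \<Longrightarrow> M < t \<Longrightarrow> decr_rearr \<alpha> y t \<le> ereal e"
        using hlp_le_uniform_tail[OF lim fin] by blast
      have "AE s in I_meas \<alpha>. M < s \<longrightarrow> \<bar>f n s\<bar> \<le> ereal e" for n
        using f(2)[of n] by eventually_elim (use M[OF z(2)[of n]] in \<open>blast intro: order_trans\<close>)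
      then show "\<exists>K. \<forall>n. AE s in I_meas \<alpha>. K < s \<longrightarrow> \<bar>f n s\<bar> \<le> ereal e" by blast
    qed
  qed
  ultimately show "(\<lambda>n. N (f n)) \<longlonglongrightarrow> 0"
    using K mem unfolding K_order_continuity_point_def by blast
qed

end

text \<open>If infinitely many terms miss a neighbourhood of \<open>l\<close>, enumerating their
  indices gives a subsequence none of whose subsequences tends to \<open>l\<close>.\<close>

lemma tendsto_if_subseq_subseq:
  fixes a :: "nat \<Rightarrow> 'a::topological_space"
  assumes "\<And>r. strict_mono (r :: nat \<Rightarrow> nat) \<Longrightarrow> \<exists>r'. strict_mono (r' :: nat \<Rightarrow> nat) \<and> (\<lambda>n. a (r (r' n))) \<longlonglongrightarrow> l"
  shows "a \<longlonglongrightarrow> l"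
proof (rule topological_tendstoI, rule ccontr)
  fix S assume S: "open S" "l \<in> S" and not: "\<not> eventually (\<lambda>n. a n \<in> S) sequentially"
  then have inf: "infinite {n. a n \<notin> S}"
    by (simp add: not_eventually frequently_cofinite cofinite_eq_sequentially[symmetric])
  obtain r' where r': "strict_mono r'" "(\<lambda>n. a (enumerate {n. a n \<notin> S} (r' n))) \<longlonglongrightarrow> l"
    using assms[OF strict_mono_enumerate[OF inf]] by blast
  have "eventually (\<lambda>n. a (enumerate {n. a n \<notin> S} (r' n)) \<in> S) sequentially"
    by (rule topological_tendstoD[OF r'(2) S])
  then show False
    using enumerate_in_set[OF inf] by auto
qed

section \<open>Extraction of a subsequence and identification of its limit\<close>

context symmetric_space
begin

lemma diff_mem: "x \<in> E \<Longrightarrow> y \<in> E \<Longrightarrow> (\<lambda>s. x s - y s) \<in> E"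
  using add_mem[of x "\<lambda>s. ereal (-1) * y s"] scale_mem[of y "-1"]
  by (simp add: minus_ereal_def one_ereal_def[symmetric] uminus_ereal.simps(1)[symmetric]
      del: uminus_ereal.simps)

text \<open>Helly selection yields a limit only along a subsequence; the full sequence is recovered
  by applying this result to each of its subsequences.\<close>

lemma LLUKM_subseq:
  assumes fatou: "fatou_property \<alpha> E N"
    and K: "K_order_continuity_point \<alpha> E N x"
    and LKM: "LKM_point \<alpha> E N x"
    and lim: "(decr_rearr \<alpha> x \<longlongrightarrow> 0) at_top"
    and X: "\<And>n. X n \<in> E" "\<And>n. hlp_le \<alpha> (X n) x" "(\<lambda>n. N (X n)) \<longlonglongrightarrow> N x"
  shows "\<exists>r. strict_mono (r :: nat \<Rightarrow> nat) \<and>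
    (\<lambda>n. N (\<lambda>t. decr_rearr \<alpha> x t - decr_rearr \<alpha> (X (r n)) t)) \<longlonglongrightarrow> 0"
proof -
  have x: "x \<in> E"
    using LKM by (simp add: LKM_point_def)
  note fin = LKM_point_rearr_integral_finite[OF LKM lim]
  obtain r where r: "strict_mono r"
    and ctble: "countable {t. \<not> (\<lambda>n. decr_rearr \<alpha> (X (r n)) t) \<longlonglongrightarrow> liminf (\<lambda>n. decr_rearr \<alpha> (X (r n)) t)}"
    by (rule ereal_Helly_antimono[of "\<lambda>n. decr_rearr \<alpha> (X n)", OF decr_rearr_antimono])
  define f where "f n = decr_rearr \<alpha> (X (r n))" for n
  \<comment> \<open>Taking the liminf makes \<open>y\<close> decreasing and nonnegative at every
    point, although convergence holds only off a countable set.\<close>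
  define y where "y t = liminf (\<lambda>n. f n t)" for t
  have f_mem: "f n \<in> E" and f_norm: "N (f n) = N (X (r n))" for n
    using decr_rearr_mem[OF X(1)] norm_decr_rearr[OF X(1)] by (auto simp: f_def)
  have f_nonneg: "0 \<le> f n t" for n t
    by (simp add: f_def decr_rearr_nonneg)
  have f_anti: "antimono (f n)" for n
    by (simp add: f_def decr_rearr_antimono)
  have [measurable]: "f n \<in> borel_measurable borel" for n
    by (rule antimono_ereal_borel_measurable[OF f_anti])
  have f_norm_lim: "(\<lambda>n. N (f n)) \<longlonglongrightarrow> N x"
    using LIMSEQ_subseq_LIMSEQ[OF X(3) r] by (simp add: f_norm o_def)
  have f_finite: "AE t in I_meas \<alpha>. \<bar>f n t\<bar> < \<infinity>" for n
    by (rule finite_AE[OF f_mem])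

  have y_nonneg: "0 \<le> y t" for t
    unfolding y_def by (intro Liminf_bounded always_eventually) (simp add: f_nonneg)
  have y_anti: "antimono y"
    unfolding y_def by (intro antimonoI Liminf_mono always_eventually) (auto intro: antimonoD[OF f_anti])
  have [measurable]: "y \<in> borel_measurable borel"
    by (rule antimono_ereal_borel_measurable[OF y_anti])
  have f_lim: "AE t in lebesgue. (\<lambda>n. f n t) \<longlonglongrightarrow> y t"
    by (rule AE_lebesgue_countable[OF ctble]) (simp add: f_def y_def)
  then have f_lim': "AE t in I_meas \<alpha>. (\<lambda>n. f n t) \<longlonglongrightarrow> y t"
    unfolding AE_I_meas_iff by eventually_elim simp

  have y_mem: "y \<in> E"
  proof -
    \<comment> \<open>The Fatou property asks for an increasing sequence. These infima increase to
      the liminf, and their norms are bounded by the convergent norms of \<open>f n\<close>.\<close>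
    define Z where "Z n t = (INF m\<in>{n..}. f m t)" for n t
    have Z: "Z n \<in> E" "N (Z n) \<le> N (f n)" "0 \<le> Z n t" for n t
    proof -
      have nonneg: "0 \<le> Z n t" for t
        unfolding Z_def by (intro INF_greatest f_nonneg)
      then show "0 \<le> Z n t" .
      have "antimono (Z n)"
        unfolding Z_def by (intro antimonoI INF_mono) (auto intro: antimonoD[OF f_anti])
      then have "Z n \<in> L0 \<alpha>"
        by (intro borel_imp_L0 antimono_ereal_borel_measurable)
      moreover have "Z n t \<le> f n t" for t
        unfolding Z_def by (rule INF_lower) simp
      ultimately show "Z n \<in> E" "N (Z n) \<le> N (f n)"
        using ideal[OF _ f_mem, of "Z n" n] by (auto simp: nonneg f_nonneg)
    qed
    have "incseq (\<lambda>n. Z n t)" for t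
      unfolding Z_def by (intro incseq_SucI INF_superset_mono) auto
    moreover have "(\<lambda>n. Z n t) \<longlonglongrightarrow> y t" for t
      using LIMSEQ_SUP[OF calculation[of t]] by (simp add: y_def Z_def liminf_SUP_INF)
    moreover have "bdd_above (range (\<lambda>n. N (Z n)))"
    proof -
      obtain B where "\<And>n. norm (N (f n)) \<le> B"
        using convergent_imp_Bseq[OF convergentI[OF f_norm_lim]] by (auto simp: Bseq_def)
      then show ?thesis
        using Z(2) by (intro bdd_aboveI[of _ B]) (auto intro: order_trans dest: abs_le_D1)
    qed
    moreover have "y \<in> L0 \<alpha>"
      by (simp add: borel_imp_L0)
    ultimately show ?thesis
      using fatou Z(1,3) unfolding fatou_property_def by (metis (no_types, lifting) AE_I2)
  qed

  have y_hlp: "hlp_le \<alpha> y x"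
    unfolding hlp_le_iff
  proof (intro allI impI)
    fix t :: real assume "0 < t"
    let ?g = "\<lambda>n s. e2ennreal (f n s) * indicator {0..t} s"
    \<comment> \<open>Since \<open>y\<close> is decreasing, its rearrangement is at most
      \<open>y\<close>, the a.e. limit of \<open>f n\<close>; Fatou's lemma for integrals then
      applies.\<close>
    have "rearr_integral \<alpha> y t \<le> (\<integral>\<^sup>+ s. liminf (\<lambda>n. ?g n s) \<partial>lebesgue)"
    proof (rule nn_integral_mono_AE)
      show "AE s in lebesgue. e2ennreal (decr_rearr \<alpha> y s) * indicator {0..t} s \<le> liminf (\<lambda>n. ?g n s)"
        using f_lim
      proof eventually_elim
        case (elim s)
        show ?case
        proof (cases "s \<in> {0..t}")
          case True
          have "liminf (\<lambda>n. e2ennreal (f n s)) = e2ennreal (y s)"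
            by (intro lim_imp_Liminf tendsto_e2ennrealI elim) simp
          with True show ?thesis
            using decr_rearr_antimono_fun_le[OF y_anti y_nonneg, of s \<alpha>] by (simp add: e2ennreal_mono)
        qed simp
      qed
    qed
    also have "\<dots> \<le> liminf (\<lambda>n. \<integral>\<^sup>+ s. ?g n s \<partial>lebesgue)"
      by (intro nn_integral_liminf measurable_completion) measurable
    also have "\<dots> \<le> liminf (\<lambda>n. rearr_integral \<alpha> x t)"
      using X(2) \<open>0 < t\<close> by (intro Liminf_mono always_eventually) (simp add: f_def hlp_le_iff)
    also have "\<dots> = rearr_integral \<alpha> x t"
      by (simp add: Liminf_const)
    finally show "rearr_integral \<alpha> y t \<le> rearr_integral \<alpha> x t" .
  qed

  define p where "p n t = max (f n t - y t) 0" for n t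
  define q where "q n t = max (y t - f n t) 0" for n t
  have y_finite: "AE t in I_meas \<alpha>. \<bar>y t\<bar> < \<infinity>"
    by (rule finite_AE[OF y_mem])
  \<comment> \<open>Finiteness of \<open>y\<close> a.e. excludes a difference of two infinities in
    the limit.\<close>
  have diff_lim: "AE t in I_meas \<alpha>. (\<lambda>n. f n t - y t) \<longlonglongrightarrow> 0 \<and> (\<lambda>n. y t - f n t) \<longlonglongrightarrow> 0"
    using f_lim' y_finite
  proof eventually_elim
    case (elim t)
    then have "(\<lambda>n. f n t - y t) \<longlonglongrightarrow> y t - y t" "(\<lambda>n. y t - f n t) \<longlonglongrightarrow> y t - y t"
      by (intro tendsto_diff_ereal tendsto_const; simp)+
    with elim show ?case by simp
  qed
  have p_lim: "AE t in I_meas \<alpha>. (\<lambda>n. p n t) \<longlonglongrightarrow> 0"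
    using diff_lim by eventually_elim (auto simp: p_def dest: tendsto_max[OF _ tendsto_const[of 0]])
  have q_lim: "AE t in I_meas \<alpha>. (\<lambda>n. q n t) \<longlonglongrightarrow> 0"
    using diff_lim by eventually_elim (auto simp: q_def dest: tendsto_max[OF _ tendsto_const[of 0]])
  have sub_le: "max (a - b) 0 \<le> a" if "0 \<le> a" "0 \<le> b" for a b :: ereal
    using that by (cases a; cases b) auto
  have p_L0: "p n \<in> L0 \<alpha>" and q_L0: "q n \<in> L0 \<alpha>" for n
    unfolding p_def q_def by (intro borel_imp_L0; measurable)+
  have p: "p n \<in> E" "(\<lambda>n. N (p n)) \<longlonglongrightarrow> 0" for n
  proof -
    have "AE t in I_meas \<alpha>. \<bar>p n t\<bar> \<le> decr_rearr \<alpha> (X (r n)) t" for n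
      using sub_le[OF f_nonneg y_nonneg] by (intro AE_I2) (simp add: p_def f_def)
    from K_order_continuity_point_tendsto_0[OF K lim fin X(1,2) p_L0 this p_lim]
    show "p n \<in> E" "(\<lambda>n. N (p n)) \<longlonglongrightarrow> 0" for n by auto
  qed

  \<comment> \<open>From \<open>f n \<le> y + p n\<close> a.e. it follows that
    \<open>N (f n) \<le> N y + N (p n)\<close>, where the left side tends to \<open>N x\<close> and
    \<open>N (p n)\<close> to \<open>0\<close>. As \<open>y\<close> is majorized by
    \<open>x\<close>, the LKM property then forces equal rearrangements.\<close>
  have "N x \<le> N y"
  proof (rule LIMSEQ_le)
    show "(\<lambda>n. N y + N (p n)) \<longlonglongrightarrow> N y"
      using tendsto_add[OF tendsto_const p(2)] by simp
    have "N (f n) \<le> N y + N (p n)" for n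
    proof -
      have "AE t in I_meas \<alpha>. \<bar>f n t\<bar> \<le> \<bar>y t + p n t\<bar>"
        using y_finite f_finite[of n]
      proof eventually_elim
        case (elim t)
        then obtain a b where "f n t = ereal a" "y t = ereal b"
          by (cases "f n t"; cases "y t") auto
        then show ?case
          using f_nonneg[of n t] y_nonneg[of t] by (auto simp: p_def max_def)
      qed
      then have "N (f n) \<le> N (\<lambda>t. y t + p n t)"
        using ideal[OF mem_L0[OF f_mem] add_mem[OF y_mem p(1)]] by blast
      also have "\<dots> \<le> N y + N (p n)"
        by (rule norm_triangle[OF y_mem p(1)])
      finally show ?thesis .
    qed
    then show "\<exists>M. \<forall>n\<ge>M. N (f n) \<le> N y + N (p n)" by blast
  qed (rule f_norm_lim)
  then have "decr_rearr \<alpha> x = decr_rearr \<alpha> y"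
    using LKM y_mem y_hlp unfolding LKM_point_def by (metis leD)
  \<comment> \<open>Being decreasing, \<open>y\<close> agrees a.e. with its own
    rearrangement.\<close>
  then have x_eq: "AE t in I_meas \<alpha>. y t = decr_rearr \<alpha> x t"
    using AE_decr_rearr_antimono_fun[OF y_anti y_nonneg, of \<alpha>] by (simp add: eq_commute)

  have q: "q n \<in> E" "(\<lambda>n. N (q n)) \<longlonglongrightarrow> 0" for n
  proof -
    \<comment> \<open>The constant sequence \<open>x\<close> serves as majorant here, because
      \<open>q n \<le> y\<close> and \<open>y\<close> is now identified.\<close>
    have "AE t in I_meas \<alpha>. \<bar>q n t\<bar> \<le> decr_rearr \<alpha> x t" for n
      using x_eq
    proof eventually_elim
      case (elim t)
      then show ?case
        using sub_le[OF y_nonneg f_nonneg, of t n t] by (simp add: q_def)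
    qed
    from K_order_continuity_point_tendsto_0[OF K lim fin x hlp_le_refl q_L0 this q_lim]
    show "q n \<in> E" "(\<lambda>n. N (q n)) \<longlonglongrightarrow> 0" for n by auto
  qed
  let ?d = "\<lambda>n t. decr_rearr \<alpha> x t - f n t"
  have d_mem: "?d n \<in> E" for n
    by (rule diff_mem[OF decr_rearr_mem[OF x] f_mem])
  have d_le: "N (?d n) \<le> N (p n) + N (q n)" for n
  proof -
    \<comment> \<open>With \<open>y\<close> in place of the rearrangement of \<open>x\<close>,
      \<open>p n\<close> and \<open>q n\<close> are the two one-sided parts of the
      difference.\<close>
    have "AE t in I_meas \<alpha>. \<bar>?d n t\<bar> \<le> \<bar>p n t + q n t\<bar>"
      using y_finite f_finite[of n] x_eq
    proof eventually_elim
      case (elim t)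
      then obtain a b where "f n t = ereal a" "y t = ereal b"
        by (cases "f n t"; cases "y t") auto
      then show ?case
        using elim by (auto simp: p_def q_def max_def)
    qed
    then have "N (?d n) \<le> N (\<lambda>t. p n t + q n t)"
      using ideal[OF mem_L0[OF d_mem] add_mem[OF p(1) q(1)]] by blast
    also have "\<dots> \<le> N (p n) + N (q n)"
      by (rule norm_triangle[OF p(1) q(1)])
    finally show ?thesis .
  qed
  have "(\<lambda>n. N (?d n)) \<longlonglongrightarrow> 0"
  proof (rule tendsto_sandwich[OF _ _ tendsto_const])
    show "(\<lambda>n. N (p n) + N (q n)) \<longlonglongrightarrow> 0"
      using tendsto_add[OF p(2) q(2)] by simp
  qed (use d_le norm_nonneg[OF d_mem] in auto)
  with r show ?thesis
    unfolding f_def by blast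
qed

end

theorem theorem3p16:
  fixes \<alpha> :: ereal
    and E :: "(real \<Rightarrow> ereal) set"
    and N :: "(real \<Rightarrow> ereal) \<Rightarrow> real"
    and x :: "real \<Rightarrow> ereal"
  assumes "\<alpha> = 1 \<or> \<alpha> = \<infinity>"
    and "symmetric_space \<alpha> E N"
    and "fatou_property \<alpha> E N"
    and "x \<in> E"
    and "K_order_continuity_point \<alpha> E N x"
    and "LKM_point \<alpha> E N x"
    and "decr_rearr_infty \<alpha> x = 0"
  shows "LLUKM_point \<alpha> E N x"
  unfolding LLUKM_point_def
proof (intro conjI allI impI assms(4))
  interpret symmetric_space \<alpha> E N by (rule assms(2))
  fix X assume X: "(\<forall>n::nat. X n \<in> E \<and> hlp_le \<alpha> (X n) x) \<and> (\<lambda>n. N (X n)) \<longlonglongrightarrow> N x"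
  note lim = decr_rearr_tendsto_infty[OF assms(1) mem_L0[OF assms(4)] assms(7)]
  show "(\<lambda>n. N (\<lambda>t. decr_rearr \<alpha> x t - decr_rearr \<alpha> (X n) t)) \<longlonglongrightarrow> 0"
  proof (rule tendsto_if_subseq_subseq)
    fix r :: "nat \<Rightarrow> nat" assume r: "strict_mono r"
    have "(\<lambda>n. N (X (r n))) \<longlonglongrightarrow> N x"
      using LIMSEQ_subseq_LIMSEQ[OF conjunct2[OF X] r] by (simp add: o_def)
    with X show "\<exists>r'. strict_mono r' \<and>
        (\<lambda>n. N (\<lambda>t. decr_rearr \<alpha> x t - decr_rearr \<alpha> (X (r (r' n))) t)) \<longlonglongrightarrow> 0"
      by (intro LLUKM_subseq[OF assms(3,5,6) lim]) auto
  qed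
qed

end
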